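(* Let $X=\{0,1\}$ and let $\nu$ be the uniform Bernoulli measure on $X^{\mathbb N}$. Let $A$ be the adding machine, i.e. the automorphism of the binary rooted tree with $A(0w)=1w$, $A(1w)=0A(w)$, and let $F$ be the automorphism given by the automaton with states $a,b,c$, initial state $a$, where $$a(0w)=1c(w),\ a(1w)=0b(w);\quad b(0w)=1b(w),\ b(1w)=0c(w);\quad c(0w)=0a(w),\ c(1w)=1a(w).$$ Let $\mu=\mathrm{Log}_A(F)_*\nu$. Then $\mu$ is finite-state. Furthermore $\mu|_0=0$ (the null measure), and $\mu|_1$ is computed by the automaton with input alphabet $X$, states $s_0,s_1,s_2,s_3,s_4,z$, initial state $s_0$, and the following transitions $\pi$ and outputs $\lambda$: $$\begin{array}{c|cc|cc} s & \pi(s,0)&\lambda(s,0)&\pi(s,1)&\lambda(s,1)\\\hline s_0&s_1&1&z&0\\ s_1&z&0&s_3&1\\ s_2&s_0&1/2&s_2&1/2\\ s_3&s_4&3/4&s_2&1/4\\ s_4&s_1&1/3&s_3&2/3\\ z&z&0&z&0\end{array}$$ That is, the states correspond bijectively to the distinct sections of $\mu|_1$ ($s_0$ to $\mu|_1$ itself, $z$ to the null measure), and if state $s$ corresponds to the section $\rho$, then $\pi(s,x)$ corresponds to $\rho|_x$ and $\lambda(s,x)=\rho(xX^{\mathbb N})$ for $x\in X$.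
   Context: $X^*$ is the set of finite words, viewed as the binary rooted tree ($w$ adjacent to $wx$). An endomorphism is a length- and adjacency-preserving map $X^*\to X^*$; it also acts on infinite words $X^{\mathbb N}$. For every $n$ and $w_1,w_2\in X^n$ there is an integer $k$, unique mod $2^n$, with $A^k(w_1)=w_2$. $\mathrm{Log}_{A,n}(F):X^n\to\mathbb Z/2^n\mathbb Z$ sends $w$ to the class of $k$ with $A^k(w)=F(w)$. Identifying $\mathbb Z/2^n\mathbb Z$ with $X^n$ via $w_0w_1\dots w_{n-1}\leftrightarrow\sum_i w_i2^i$, the maps $\mathrm{Log}_{A,n}(F)$ for all $n$ are compatible with deletion of last letters and together define $\mathrm{Log}_A(F):X^{\mathbb N}\to X^{\mathbb N}$ (whose length-$n$ prefix on input $\xi$ is $\mathrm{Log}_{A,n}(F)$ of the length-$n$ prefix of $\xi$). The uniform Bernoulli measure satisfies $\nu(wX^{\mathbb N})=2^{-|w|}$, where $wX^{\mathbb N}$ is the cylinder of infinite words with prefix $w$. The pushforward is $g_*\nu(E)=\nu(g^{-1}(E))$. For a probability measure $\mu$ on $X^{\mathbb N}$ and a word $w$, the section $\mu|_w$ is the probability measure $\mu|_w(vX^{\mathbb N})=\mu(wvX^{\mathbb N})/\mu(wX^{\mathbb N})$ if $\mu(wX^{\mathbb N})\neq0$, and the null measure if $\mu(wX^{\mathbb N})=0$; all sections of the null measure are null. $\mu$ is finite-state if it has only finitely many distinct sections $\mu|_w$, $w\in X^*$ (the empty word included). *)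

theory Defs
  imports "HOL-Probability.Probability" "HOL-Number_Theory.Cong"
begin

text \<open>The alphabet \<open>{0, 1}\<close> is \<^typ>\<open>bool\<close>, with \<^const>\<open>False\<close> for \<open>0\<close> and \<^const>\<open>True\<close> for \<open>1\<close>;
  finite words are lists and infinite words are streams.\<close>

type_synonym word = "bool list"
type_synonym seq = "bool stream"

fun adding_machine :: "word \<Rightarrow> word" where
  "adding_machine [] = []"
| "adding_machine (False # w) = True # w"
| "adding_machine (True # w) = False # adding_machine w"

fun state_a :: "word \<Rightarrow> word" and state_b :: "word \<Rightarrow> word" and state_c :: "word \<Rightarrow> word" where
  "state_a [] = []"
| "state_a (False # w) = True # state_c w"
| "state_a (True # w) = False # state_b w"
| "state_b [] = []"
| "state_b (False # w) = True # state_b w"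
| "state_b (True # w) = False # state_c w"
| "state_c [] = []"
| "state_c (False # w) = False # state_a w"
| "state_c (True # w) = True # state_a w"

text \<open>Intended for bijective \<open>f\<close> only; see \<open>bij_adding_machine\<close> below.\<close>

definition int_funpow :: "('a \<Rightarrow> 'a) \<Rightarrow> int \<Rightarrow> 'a \<Rightarrow> 'a" where
  "int_funpow f k = (if k \<ge> 0 then f ^^ nat k else inv f ^^ nat (- k))"

text \<open>The residue class modulo \<open>2 ^ length w\<close> that is the logarithm of \<open>F\<close> at \<open>w\<close>,
  as a set of integers; see \<open>log_class_adding_machine\<close> below.\<close>

definition log_class :: "(word \<Rightarrow> word) \<Rightarrow> (word \<Rightarrow> word) \<Rightarrow> word \<Rightarrow> int set" where
  "log_class A F w = {k. int_funpow A k w = F w}"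

text \<open>The same class, as a word: \<open>horner_sum of_bool 2 v\<close> is the sum of all \<open>v ! i * 2 ^ i\<close>.\<close>

definition log_word :: "(word \<Rightarrow> word) \<Rightarrow> (word \<Rightarrow> word) \<Rightarrow> word \<Rightarrow> word" where
  "log_word A F w = (THE v. length v = length w \<and> horner_sum of_bool 2 v \<in> log_class A F w)"

definition log_seq :: "(word \<Rightarrow> word) \<Rightarrow> (word \<Rightarrow> word) \<Rightarrow> seq \<Rightarrow> seq" where
  "log_seq A F \<xi> = (THE \<eta>. \<forall>n. stake n \<eta> = log_word A F (stake n \<xi>))"

abbreviation seq_space :: "seq measure" where
  "seq_space \<equiv> stream_space (count_space UNIV)"

definition cylinder :: "word \<Rightarrow> seq set" where
  "cylinder w = {\<xi>. stake (length w) \<xi> = w}"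

definition uniform_bernoulli :: "seq measure" where
  "uniform_bernoulli = stream_space (measure_pmf (pmf_of_set UNIV))"

text \<open>For \<open>M (cylinder w) \<noteq> 0\<close> the section is the conditional measure on the cylinder,
  transported by deleting the prefix \<open>w\<close>; \<open>emeasure_section\<close> below gives its values on cylinders.\<close>

definition section_measure :: "seq measure \<Rightarrow> word \<Rightarrow> seq measure" where
  "section_measure M w =
     (if emeasure M (cylinder w) = 0 then null_measure seq_space
      else distr (uniform_measure M (cylinder w)) seq_space (sdrop (length w)))"

definition finite_state :: "seq measure \<Rightarrow> bool" where
  "finite_state M \<longleftrightarrow> finite (range (section_measure M))"

definition log_measure :: "seq measure" where
  "log_measure = distr uniform_bernoulli seq_space (log_seq adding_machine state_a)"

datatype log_state = S0 | S1 | S2 | S3 | S4 | Z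

fun next_state :: "log_state \<Rightarrow> bool \<Rightarrow> log_state" where
  "next_state S0 False = S1" | "next_state S0 True = Z"
| "next_state S1 False = Z"  | "next_state S1 True = S3"
| "next_state S2 False = S0" | "next_state S2 True = S2"
| "next_state S3 False = S4" | "next_state S3 True = S2"
| "next_state S4 False = S1" | "next_state S4 True = S3"
| "next_state Z False = Z"   | "next_state Z True = Z"

fun out_prob :: "log_state \<Rightarrow> bool \<Rightarrow> real" where
  "out_prob S0 False = 1"     | "out_prob S0 True = 0"
| "out_prob S1 False = 0"     | "out_prob S1 True = 1"
| "out_prob S2 False = 1 / 2" | "out_prob S2 True = 1 / 2"
| "out_prob S3 False = 3 / 4" | "out_prob S3 True = 1 / 4"
| "out_prob S4 False = 1 / 3" | "out_prob S4 True = 2 / 3"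
| "out_prob Z False = 0"      | "out_prob Z True = 0"

lemma length_adding_machine [simp]: "length (adding_machine w) = length w"
  by (induction w rule: adding_machine.induct) auto

lemma length_states [simp]:
  "length (state_a w) = length w" "length (state_b w) = length w" "length (state_c w) = length w"
  by (induction w and w and w rule: state_a_state_b_state_c.induct) auto

lemma adding_machine_cong:
  "[horner_sum of_bool 2 (adding_machine w) = horner_sum of_bool 2 w + (1::int)] (mod 2 ^ length w)"
proof (induction w rule: adding_machine.induct)
  case (3 w)
  from cong_scalar_left [OF cong_modulus_mult] 3
  have "(2::int) ^ length w dvd horner_sum of_bool 2 (adding_machine w) - (horner_sum of_bool 2 w + 1)"
    by (simp add: cong_iff_dvd_diff)
  then have "(2::int) * 2 ^ length w dvd 2 * (horner_sum of_bool 2 (adding_machine w) - (horner_sum of_bool 2 w + 1))"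
    by (rule mult_dvd_mono [OF dvd_refl])
  then show ?case
    by (simp add: cong_iff_dvd_diff algebra_simps)
qed (simp_all add: add.commute)

lemma horner_sum_cong_imp_eq:
  "length v = length w \<Longrightarrow>
   [horner_sum of_bool 2 v = (horner_sum of_bool 2 w :: int)] (mod 2 ^ length w) \<Longrightarrow> v = w"
proof (induction v w rule: list_induct2)
  case (Cons x v y w)
  let ?s = "horner_sum of_bool (2::int)"
  from Cons.prems have d: "2 * 2 ^ length w dvd (of_bool x + 2 * ?s v) - (of_bool y + 2 * ?s w)"
    by (simp add: cong_iff_dvd_diff)
  then have "2 dvd (of_bool x + 2 * ?s v) - (of_bool y + 2 * ?s w)"
    using dvd_mult_left by blast
  then have xy: "x = y"
    by (cases x; cases y) auto
  with d have "2 * 2 ^ length w dvd 2 * (?s v - ?s w)"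
    by (simp add: algebra_simps)
  then have "2 ^ length w dvd ?s v - ?s w"
    by (subst (asm) dvd_times_left_cancel_iff) simp_all
  with Cons.IH xy show ?case
    by (simp add: cong_iff_dvd_diff)
qed simp

lemma horner_sum_surj:
  "\<exists>v. length v = n \<and> [horner_sum of_bool 2 v = (k::int)] (mod 2 ^ n)"
  by (intro exI [of _ "map (bit k) [0..<n]"])
    (simp add: horner_sum_bit_eq_take_bit take_bit_eq_mod cong_def)

lemma bij_adding_machine: "bij adding_machine"
proof (rule bijI)
  have inj: "adding_machine v = adding_machine w \<Longrightarrow> v = w" for v w
  proof (rule horner_sum_cong_imp_eq)
    assume *: "adding_machine v = adding_machine w"
    show l: "length v = length w"
      using arg_cong [OF *, of length] by simp
    have "[horner_sum of_bool 2 v + 1 = horner_sum of_bool 2 w + (1::int)] (mod 2 ^ length w)"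
      using adding_machine_cong [of v] adding_machine_cong [of w] * l by (metis cong_sym cong_trans)
    then show "[horner_sum of_bool 2 v = (horner_sum of_bool 2 w :: int)] (mod 2 ^ length w)"
      by (simp only: cong_add_rcancel)
  qed
  then show "inj adding_machine"
    by (rule injI)
  have "\<exists>w. adding_machine w = v" for v
  proof (induction v)
    case Nil
    show ?case by (rule exI [of _ "[]"]) simp
  next
    case (Cons x v)
    then obtain w where "adding_machine w = v" by blast
    then show ?case
      by (cases x) (auto intro: exI [of _ "False # v"] exI [of _ "True # w"])
  qed
  then show "surj adding_machine"
    by (metis surjI)
qed

lemma int_funpow_adding_machine:
  "length (int_funpow adding_machine k w) = length w"
  "[horner_sum of_bool 2 (int_funpow adding_machine k w) = horner_sum of_bool 2 w + k] (mod 2 ^ length w)"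
proof -
  let ?s = "horner_sum of_bool (2::int)" and ?B = "inv adding_machine"
  have pos: "length ((adding_machine ^^ n) w) = length w \<and>
      [?s ((adding_machine ^^ n) w) = ?s w + int n] (mod 2 ^ length w)" for n
  proof (induction n)
    case (Suc n)
    then have "[?s (adding_machine ((adding_machine ^^ n) w)) = ?s ((adding_machine ^^ n) w) + 1] (mod 2 ^ length w)"
      using adding_machine_cong [of "(adding_machine ^^ n) w"] by simp
    also have "[?s ((adding_machine ^^ n) w) + 1 = (?s w + int n) + 1] (mod 2 ^ length w)"
      using Suc by (intro cong_add) auto
    finally show ?case using Suc by (simp add: algebra_simps)
  qed auto
  have inv: "adding_machine (?B v) = v" for v
    using bij_adding_machine by (simp add: bij_is_surj surj_f_inv_f)
  have invl: "length (?B v) = length v" for v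
    by (metis inv length_adding_machine)
  have neg: "length ((?B ^^ n) w) = length w \<and>
      [?s ((?B ^^ n) w) = ?s w - int n] (mod 2 ^ length w)" for n
  proof (induction n)
    case (Suc n)
    have "[?s ((?B ^^ n) w) = ?s (?B ((?B ^^ n) w)) + 1] (mod 2 ^ length w)"
      using adding_machine_cong [of "?B ((?B ^^ n) w)"] Suc by (simp add: inv invl)
    with Suc have "[?s (?B ((?B ^^ n) w)) + 1 = ?s w - int n] (mod 2 ^ length w)"
      unfolding cong_def by metis
    then have "[?s (?B ((?B ^^ n) w)) = ?s w - int n - 1] (mod 2 ^ length w)"
      by (simp add: cong_iff_dvd_diff algebra_simps)
    with Suc show ?case by (simp add: invl algebra_simps)
  qed auto
  show "length (int_funpow adding_machine k w) = length w"
    "[?s (int_funpow adding_machine k w) = ?s w + k] (mod 2 ^ length w)"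
    using pos [of "nat k"] neg [of "nat (- k)"] by (auto simp: int_funpow_def)
qed

text \<open>Existence and uniqueness of the logarithm: its class is exactly one residue class.\<close>

lemma log_class_adding_machine_iff:
  assumes "length (F w) = length w"
  shows "k \<in> log_class adding_machine F w \<longleftrightarrow>
    [k = horner_sum of_bool 2 (F w) - horner_sum of_bool 2 w] (mod 2 ^ length w)"
    (is "_ \<longleftrightarrow> [k = ?d] (mod _)")
proof -
  have "k \<in> log_class adding_machine F w \<longleftrightarrow>
    [horner_sum of_bool 2 (int_funpow adding_machine k w) = (horner_sum of_bool 2 (F w) :: int)] (mod 2 ^ length w)"
    using horner_sum_cong_imp_eq [of "int_funpow adding_machine k w" "F w"] assms
    by (auto simp: log_class_def int_funpow_adding_machine(1))
  also have "\<dots> \<longleftrightarrow> [horner_sum of_bool 2 w + k = (horner_sum of_bool 2 (F w) :: int)] (mod 2 ^ length w)"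
    using int_funpow_adding_machine(2) [of k w] by (metis cong_sym cong_trans)
  also have "\<dots> \<longleftrightarrow> [k = ?d] (mod 2 ^ length w)"
    by (simp add: cong_iff_dvd_diff algebra_simps)
  finally show ?thesis .
qed

lemma log_class_adding_machine:
  assumes "length (F w) = length w"
  shows "\<exists>k. log_class adding_machine F w = {j. [j = k] (mod 2 ^ length w)}"
  using log_class_adding_machine_iff [of F w] assms by blast

lemma log_word_adding_machine:
  assumes "length (F w) = length w"
  shows "length (log_word adding_machine F w) = length w"
    "horner_sum of_bool 2 (log_word adding_machine F w) \<in> log_class adding_machine F w"
proof -
  have "\<exists>!v. length v = length w \<and> horner_sum of_bool 2 v \<in> log_class adding_machine F w"
  proof (rule ex_ex1I)
    show "\<exists>v. length v = length w \<and> horner_sum of_bool 2 v \<in> log_class adding_machine F w"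
      using horner_sum_surj by (simp add: log_class_adding_machine_iff assms)
    show "v = v'" if "length v = length w \<and> horner_sum of_bool 2 v \<in> log_class adding_machine F w"
      "length v' = length w \<and> horner_sum of_bool 2 v' \<in> log_class adding_machine F w" for v v'
      using that by (intro horner_sum_cong_imp_eq)
        (simp_all only: log_class_adding_machine_iff [of F w, OF assms] cong_def)
  qed
  from theI' [OF this] show "length (log_word adding_machine F w) = length w"
    "horner_sum of_bool 2 (log_word adding_machine F w) \<in> log_class adding_machine F w"
    by (auto simp: log_word_def)
qed

lemma take_states:
  "take n (state_a w) = state_a (take n w)" "take n (state_b w) = state_b (take n w)"
  "take n (state_c w) = state_c (take n w)"
  by (induction w and w and w arbitrary: n and n and n rule: state_a_state_b_state_c.induct)
    (case_tac n; simp)+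

lemma horner_sum_take_cong:
  "n \<le> length w \<Longrightarrow> [horner_sum of_bool 2 (take n w) = (horner_sum of_bool 2 w :: int)] (mod 2 ^ n)"
proof (induction w arbitrary: n)
  case (Cons x w)
  show ?case
  proof (cases n)
    case (Suc m)
    with Cons have "[horner_sum of_bool 2 (take m w) = (horner_sum of_bool 2 w :: int)] (mod 2 ^ m)"
      by simp
    then have "(2::int) * 2 ^ m dvd 2 * (horner_sum of_bool 2 (take m w) - horner_sum of_bool 2 w)"
      unfolding cong_iff_dvd_diff by (rule mult_dvd_mono [OF dvd_refl])
    then show ?thesis using Suc
      by (simp add: cong_iff_dvd_diff algebra_simps)
  qed simp
qed simp

lemma take_log_word:
  assumes len: "\<And>w. length (F w) = length w" and pre: "\<And>n w. take n (F w) = F (take n w)"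
    and n: "n \<le> length w"
  shows "take n (log_word adding_machine F w) = log_word adding_machine F (take n w)"
proof -
  let ?s = "horner_sum of_bool (2::int)"
  let ?v = "log_word adding_machine F w" and ?u = "log_word adding_machine F (take n w)"
  have l: "length ?v = length w" "length ?u = n"
    using log_word_adding_machine(1) [of F] len n by auto
  have "[?s ?v = ?s (F w) - ?s w] (mod 2 ^ length w)"
    using log_word_adding_machine(2) [of F w] len by (simp add: log_class_adding_machine_iff)
  then have 1: "[?s ?v = ?s (F w) - ?s w] (mod 2 ^ n)"
    by (rule cong_dvd_modulus) (use n in \<open>simp add: le_imp_power_dvd\<close>)
  have 2: "[?s ?u = ?s (F (take n w)) - ?s (take n w)] (mod 2 ^ n)"
    using log_word_adding_machine(2) [of F "take n w"] len n by (simp add: log_class_adding_machine_iff)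
  have 3: "[?s (F (take n w)) - ?s (take n w) = ?s (F w) - ?s w] (mod 2 ^ n)"
    unfolding pre [symmetric] using n by (intro cong_diff horner_sum_take_cong) (simp_all add: len)
  have 4: "[?s (take n ?v) = ?s ?v] (mod 2 ^ n)"
    using n by (intro horner_sum_take_cong) (simp add: l)
  from 1 2 3 4 have "[?s (take n ?v) = ?s ?u] (mod 2 ^ n)"
    by (simp only: cong_def)
  with l n show ?thesis
    by (intro horner_sum_cong_imp_eq) simp_all
qed

lemma stake_log_seq:
  assumes len: "\<And>w. length (F w) = length w" and pre: "\<And>n w. take n (F w) = F (take n w)"
  shows "stake n (log_seq adding_machine F \<xi>) = log_word adding_machine F (stake n \<xi>)"
proof -
  let ?L = "log_word adding_machine F"
  define \<eta> where "\<eta> = smap (\<lambda>i. ?L (stake (Suc i) \<xi>) ! i) nats"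
  have l: "length (?L w) = length w" for w
    using log_word_adding_machine(1) len by blast
  have ex: "stake n \<eta> = ?L (stake n \<xi>)" for n
  proof (rule nth_equalityI)
    fix i assume "i < length (stake n \<eta>)"
    then have i: "i < n" by simp
    have "?L (stake (Suc i) \<xi>) = take (Suc i) (?L (stake n \<xi>))"
      using take_log_word [OF len pre, of "Suc i" "stake n \<xi>"] i by (simp add: take_stake min_def)
    then show "stake n \<eta> ! i = ?L (stake n \<xi>) ! i"
      using i by (simp add: \<eta>_def)
  qed (simp add: l)
  have uniq: "\<eta>' = \<eta>" if "\<forall>n. stake n \<eta>' = ?L (stake n \<xi>)" for \<eta>'
  proof -
    have "\<eta>' !! i = \<eta> !! i" for i
      using that ex [of "Suc i"] stake_nth [of i "Suc i"] by (metis lessI)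
    then have "snth \<eta>' = snth \<eta>"
      by blast
    then show ?thesis
      by (metis stream_smap_nats)
  qed
  have "log_seq adding_machine F \<xi> = \<eta>"
    unfolding log_seq_def using ex uniq by (intro the_equality) auto
  with ex show ?thesis by simp
qed

lemma sets_uniform_bernoulli: "sets uniform_bernoulli = sets seq_space"
  unfolding uniform_bernoulli_def by (rule sets_stream_space_cong) simp

lemma measurable_log_seq:
  assumes "\<And>w. length (F w) = length w" and "\<And>n w. take n (F w) = F (take n w)"
  shows "log_seq adding_machine F \<in> measurable seq_space seq_space"
proof (rule measurable_stream_space2)
  fix n
  have "log_seq adding_machine F \<xi> !! n = log_word adding_machine F (stake (Suc n) \<xi>) ! n" for \<xi>
    using stake_log_seq [OF assms, of "Suc n" \<xi>] stake_nth [of n "Suc n"] by (metis lessI)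
  then show "(\<lambda>\<xi>. log_seq adding_machine F \<xi> !! n) \<in> measurable seq_space (count_space UNIV)"
    using measurable_compose [OF measurable_stake measurable_count_space] by simp
qed

lemma cylinder_in_sets [measurable]: "cylinder w \<in> sets seq_space"
proof -
  have "Measurable.pred seq_space (\<lambda>\<xi>. stake (length w) \<xi> = w)"
    by measurable
  then show ?thesis
    by (simp add: cylinder_def pred_def space_stream_space)
qed

lemma prob_space_uniform_bernoulli: "prob_space uniform_bernoulli"
  unfolding uniform_bernoulli_def by (rule prob_space.prob_space_stream_space [OF prob_space_measure_pmf])

lemma prob_space_log_measure: "prob_space log_measure"
  unfolding log_measure_def
  using measurable_log_seq [OF length_states(1) take_states(1)] sets_uniform_bernoulli
  by (intro prob_space.prob_space_distr [OF prob_space_uniform_bernoulli])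
    (simp cong: measurable_cong_sets)

lemma emeasure_uniform_bernoulli_cylinder: "emeasure uniform_bernoulli (cylinder w) = ennreal ((1 / 2) ^ length w)"
proof -
  let ?p = "measure_pmf (pmf_of_set (UNIV :: bool set))"
  note p = prob_space_measure_pmf [of "pmf_of_set (UNIV :: bool set)"]
  interpret S: prob_space "stream_space ?p"
    by (rule prob_space.prob_space_stream_space [OF p])
  have sp: "space (stream_space ?p) = UNIV"
    by (simp add: space_stream_space)
  have sets: "cylinder w \<in> sets (stream_space ?p)" for w
    using sets_uniform_bernoulli cylinder_in_sets by (simp add: uniform_bernoulli_def)
  show ?thesis
    unfolding uniform_bernoulli_def
  proof (induction w)
    case Nil
    then show ?case
      using S.emeasure_space_1 by (simp add: cylinder_def sp)
  next
    case (Cons y w)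
    have "{\<xi> \<in> space (stream_space ?p). x ## \<xi> \<in> cylinder (y # w)} = (if x = y then cylinder w else {})" for x
      by (auto simp: cylinder_def sp)
    then have "emeasure (stream_space ?p) (cylinder (y # w)) =
        (\<integral>\<^sup>+x. emeasure (stream_space ?p) (if x = y then cylinder w else {}) \<partial>?p)"
      using prob_space.emeasure_stream_space [OF p sets] by simp
    also have "\<dots> = emeasure (stream_space ?p) (cylinder w) / 2"
      by (cases y) (simp_all add: nn_integral_pmf_of_set UNIV_bool)
    finally show ?case
      using Cons by (simp flip: ennreal_numeral add: divide_ennreal)
  qed
qed

lemma emeasure_section:
  assumes M: "sets M = sets seq_space" and "emeasure M (cylinder w) \<noteq> 0"
  shows "emeasure (section_measure M w) (cylinder v) =
    emeasure M (cylinder (w @ v)) / emeasure M (cylinder w)"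
proof -
  have sp: "space M = UNIV"
    using sets_eq_imp_space_eq [OF M] by (simp add: space_stream_space)
  have [measurable]: "sdrop (length w) \<in> M \<rightarrow>\<^sub>M seq_space"
    using M by (simp cong: measurable_cong_sets)
  have [measurable]: "cylinder u \<in> sets M" for u
    by (simp add: M cylinder_in_sets)
  have *: "cylinder w \<inter> sdrop (length w) -` cylinder v = cylinder (w @ v)"
    by (simp add: cylinder_def set_eq_iff flip: stake_add)
  have "emeasure (section_measure M w) (cylinder v) =
      emeasure (uniform_measure M (cylinder w)) (sdrop (length w) -` cylinder v \<inter> space M)"
    using assms(2) by (simp add: section_measure_def emeasure_distr cylinder_in_sets)
  also have "\<dots> = emeasure M (cylinder w \<inter> (sdrop (length w) -` cylinder v \<inter> space M)) / emeasure M (cylinder w)"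
    by (rule emeasure_uniform_measure) (auto intro: measurable_sets [of _ _ seq_space] cylinder_in_sets)
  finally show ?thesis by (simp add: sp *)
qed

end

theory Submission
  imports Defs
begin

text \<open>The logarithm satisfies \<open>Log(F)(\<xi>) = F(\<xi>) - \<xi>\<close> in the 2-adic integers. For each state \<open>s\<close> of
  the automaton of \<open>F\<close>, the maps \<open>s(\<xi>) - \<xi>\<close> and \<open>s(\<xi>) - \<xi> - 1\<close> (the latter absorbing the borrow)
  are again computed letter by letter, so together they form a six-state transducer. The cylinder
  probabilities of the pushforwards of \<open>\<nu>\<close> under its states therefore satisfy linear recurrences,
  and the sections of \<open>\<mu>|\<^sub>1\<close> are convex combinations of these six measures that the recurrences
  permute up to normalisation as in the table. The states have pairwise different output rows, so
  the sections are pairwise distinct.\<close>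

section \<open>The transducer of the logarithm\<close>

text \<open>\<open>diff_s w\<close> is \<open>s(w) - w\<close> and \<open>pred_s w\<close> is \<open>s(w) - w - 1\<close>, modulo \<open>2 ^ length w\<close>.\<close>

fun diff_a :: "word \<Rightarrow> word" and diff_b :: "word \<Rightarrow> word" and diff_c :: "word \<Rightarrow> word"
  and pred_a :: "word \<Rightarrow> word" and pred_b :: "word \<Rightarrow> word" and pred_c :: "word \<Rightarrow> word" where
  "diff_a [] = []"
| "diff_a (x # w) = True # (if x then pred_b w else diff_c w)"
| "diff_b [] = []"
| "diff_b (x # w) = True # (if x then pred_c w else diff_b w)"
| "diff_c [] = []"
| "diff_c (x # w) = False # diff_a w"
| "pred_a [] = []"
| "pred_a (x # w) = False # (if x then pred_b w else diff_c w)"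
| "pred_b [] = []"
| "pred_b (x # w) = False # (if x then pred_c w else diff_b w)"
| "pred_c [] = []"
| "pred_c (x # w) = True # pred_a w"

lemma length_diff [simp]:
  "length (diff_a w) = length w" "length (diff_b w) = length w" "length (diff_c w) = length w"
  "length (pred_a w) = length w" "length (pred_b w) = length w" "length (pred_c w) = length w"
  by (induction w and w and w and w and w and w
      rule: diff_a_diff_b_diff_c_pred_a_pred_b_pred_c.induct) auto

text \<open>Prepending a letter doubles the value of a word. Once the contributions of the first
  letters cancel, a congruence between tails thus lifts to the whole words.\<close>

lemma cong_double:
  fixes a b m n x y :: int
  assumes "[a = b] (mod m)" "n = 2 * m" "x - y = 2 * (a - b)"
  shows "[x = y] (mod n)"
  using assms(1) unfolding cong_iff_dvd_diff assms(2,3) by (rule mult_dvd_mono [OF dvd_refl])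

text \<open>Joint induction, as the six maps call each other. A first-letter contribution of -1 is
  written as 1 + 2 * (-1), and -2 as 0 + 2 * (-1); either way 1 is borrowed from the tails, which is
  what the \<open>pred\<close> maps record.\<close>

lemma diff_cong:
  fixes w :: word
  defines "h \<equiv> horner_sum of_bool (2 :: int)"
  shows "[h (diff_a w) = h (state_a w) - h w] (mod 2 ^ length w)"
    "[h (diff_b w) = h (state_b w) - h w] (mod 2 ^ length w)"
    "[h (diff_c w) = h (state_c w) - h w] (mod 2 ^ length w)"
    "[h (pred_a w) = h (state_a w) - h w - 1] (mod 2 ^ length w)"
    "[h (pred_b w) = h (state_b w) - h w - 1] (mod 2 ^ length w)"
    "[h (pred_c w) = h (state_c w) - h w - 1] (mod 2 ^ length w)"
proof (induction w)
  case (Cons x w)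
  note step = Cons.IH [THEN cong_double]
  {
    case 1 show ?case by (cases x) (rule step(5,3); simp add: h_def; fail)+
  next
    case 2 show ?case by (cases x) (rule step(6,2); simp add: h_def; fail)+
  next
    case 3 show ?case by (cases x) (rule step(1); simp add: h_def; fail)+
  next
    case 4 show ?case by (cases x) (rule step(5,3); simp add: h_def; fail)+
  next
    case 5 show ?case by (cases x) (rule step(6,2); simp add: h_def; fail)+
  next
    case 6 show ?case by (cases x) (rule step(4); simp add: h_def; fail)+
  }
qed simp_all

lemma log_word_state_a: "log_word adding_machine state_a w = diff_a w"
proof (rule horner_sum_cong_imp_eq)
  show "length (log_word adding_machine state_a w) = length (diff_a w)"
    by (simp add: log_word_adding_machine)
  have "[horner_sum of_bool 2 (log_word adding_machine state_a w) =
      horner_sum of_bool 2 (state_a w) - (horner_sum of_bool 2 w :: int)] (mod 2 ^ length w)"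
    using log_word_adding_machine(2) [of state_a w] by (simp add: log_class_adding_machine_iff)
  then show "[horner_sum of_bool 2 (log_word adding_machine state_a w) =
      (horner_sum of_bool 2 (diff_a w) :: int)] (mod 2 ^ length (diff_a w))"
    using diff_cong(1) [of w] by (simp add: cong_def)
qed

section \<open>Cylinder probabilities of the image measures\<close>

text \<open>If \<open>f\<close> acts on prefixes of infinite words, this is the mass that the
  pushforward of \<nu> gives to \<open>cylinder v\<close>. Counting words keeps measure theory out
  of the recurrences.\<close>

definition image_prob :: "(word \<Rightarrow> word) \<Rightarrow> word \<Rightarrow> real" where
  "image_prob f v = card {w. length w = length v \<and> f w = v} / 2 ^ length v"

lemma image_prob_Nil: "f [] = [] \<Longrightarrow> image_prob f [] = 1"
proof -
  assume "f [] = []"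
  then have "{w. length w = length [] \<and> f w = []} = {[]}"
    by auto
  then show ?thesis
    unfolding image_prob_def by simp
qed

text \<open>The first output letter \<open>y\<close> is the same for both inputs, so the preimages
  of \<open>z # v\<close> either do not exist or split by first letter into those under
  \<open>g\<close> and those under \<open>h\<close>.\<close>

lemma image_prob_Cons:
  assumes "\<And>x w. f (x # w) = y # (if x then g w else h w)"
  shows "image_prob f (z # v) = (if z = y then (image_prob g v + image_prob h v) / 2 else 0)"
proof (cases "z = y")
  case True
  let ?S = "\<lambda>k :: word \<Rightarrow> word. {w. length w = length v \<and> k w = v}"
  have fin: "finite (?S k)" for k
    by (rule finite_subset [OF _ finite_lists_length_eq [of UNIV "length v"]]) auto
  have "{w. length w = length (z # v) \<and> f w = z # v} = (#) True ` ?S g \<union> (#) False ` ?S h"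
    (is "?L = ?R")
  proof (rule set_eqI)
    fix u
    show "u \<in> ?L \<longleftrightarrow> u \<in> ?R"
      using True assms by (cases u) auto
  qed
  moreover have "card ?R = card (?S g) + card (?S h)"
    by (subst card_Un_disjoint) (auto simp: fin card_image)
  ultimately show ?thesis
    using True by (simp add: image_prob_def add_divide_distrib)
next
  case False
  then have *: "{w. length w = length (z # v) \<and> f w = z # v} = {}"
    using assms by (auto simp: length_Suc_conv)
  have "image_prob f (z # v) = 0"
    unfolding image_prob_def * by simp
  with False show ?thesis
    by simp
qed

lemmas image_prob_diff_Nil =
  image_prob_Nil [of diff_a, simplified] image_prob_Nil [of diff_b, simplified]
  image_prob_Nil [of diff_c, simplified] image_prob_Nil [of pred_a, simplified]
  image_prob_Nil [of pred_b, simplified] image_prob_Nil [of pred_c, simplified]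

lemmas image_prob_diff_Cons =
  image_prob_Cons [of diff_a True pred_b diff_c, simplified]
  image_prob_Cons [of diff_b True pred_c diff_b, simplified]
  image_prob_Cons [of diff_c False diff_a diff_a, simplified]
  image_prob_Cons [of pred_a False pred_b diff_c, simplified]
  image_prob_Cons [of pred_b False pred_c diff_b, simplified]
  image_prob_Cons [of pred_c True pred_a pred_a, simplified]

text \<open>The preimage of a cylinder is the disjoint union of the cylinders over the words that
  \<open>diff_a\<close> maps to \<open>v\<close>, each of mass 2^(-n) with n the length of
  \<open>v\<close>.\<close>

lemma emeasure_log_measure_cylinder:
  "emeasure log_measure (cylinder v) = ennreal (image_prob diff_a v)"
proof -
  let ?S = "{w. length w = length v \<and> diff_a w = v}"
  have fin: "finite ?S"
    by (rule finite_subset [OF _ finite_lists_length_eq [of UNIV "length v"]]) auto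
  have sp: "space uniform_bernoulli = UNIV"
    using sets_eq_imp_space_eq [OF sets_uniform_bernoulli] by (simp add: space_stream_space)
  have meas: "log_seq adding_machine state_a \<in> uniform_bernoulli \<rightarrow>\<^sub>M seq_space"
    using measurable_log_seq [OF length_states(1) take_states(1)] sets_uniform_bernoulli
    by (simp cong: measurable_cong_sets)
  have "log_seq adding_machine state_a -` cylinder v = (\<Union>w\<in>?S. cylinder w)"
    by (auto simp: cylinder_def stake_log_seq [OF length_states(1) take_states(1)] log_word_state_a)
  then have "emeasure log_measure (cylinder v) = emeasure uniform_bernoulli (\<Union>w\<in>?S. cylinder w)"
    unfolding log_measure_def by (simp add: emeasure_distr [OF meas cylinder_in_sets] sp)
  also have "\<dots> = (\<Sum>w\<in>?S. emeasure uniform_bernoulli (cylinder w))"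
  proof (rule sum_emeasure [symmetric])
    show "cylinder ` ?S \<subseteq> sets uniform_bernoulli"
      using cylinder_in_sets sets_uniform_bernoulli by blast
    show "disjoint_family_on cylinder ?S"
      unfolding disjoint_family_on_def
    proof (intro ballI impI)
      fix w u :: word
      assume "w \<in> ?S" "u \<in> ?S" "w \<noteq> u"
      then have "length w = length u" "w \<noteq> u"
        by simp_all
      then show "cylinder w \<inter> cylinder u = {}"
        unfolding cylinder_def by force
    qed
  qed (rule fin)
  also have "\<dots> = (\<Sum>w\<in>?S. ennreal ((1 / 2) ^ length v))"
    by (intro sum.cong) (simp_all add: emeasure_uniform_bernoulli_cylinder)
  also have "\<dots> = ennreal (\<Sum>w\<in>?S. (1 / 2) ^ length v)"
    by (rule sum_ennreal) simp
  also have "(\<Sum>w\<in>?S. (1 / 2 :: real) ^ length v) = image_prob diff_a v"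
    by (simp add: image_prob_def power_one_over)
  finally show ?thesis .
qed

section \<open>Measures computed by the output automaton\<close>

text \<open>The value at the empty word is the total mass of the measure: 0 for the null state, 1
  otherwise.\<close>

fun word_prob :: "log_state \<Rightarrow> word \<Rightarrow> real" where
  "word_prob s [] = of_bool (s \<noteq> Z)"
| "word_prob s (x # w) = out_prob s x * word_prob (next_state s x) w"

text \<open>\<open>S0\<close> is the even mixture to which \<open>diff_a\<close> moves after its
  output \<open>True\<close>. The other weights arise by following transitions: apply
  \<open>image_prob_Cons\<close> to each summand and rescale the weights to sum 1; the factor
  removed is \<open>out_prob\<close>.\<close>

lemma image_prob_diff_eq_word_prob:
  "word_prob S0 v = image_prob diff_c v / 2 + image_prob pred_b v / 2"
  "word_prob S1 v = image_prob diff_a v / 2 + image_prob diff_b v / 4 + image_prob pred_c v / 4"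
  "word_prob S2 v = image_prob pred_a v / 2 + image_prob diff_b v / 4 + image_prob pred_c v / 4"
  "word_prob S3 v = image_prob diff_c v / 4 + image_prob pred_b v / 4 + image_prob diff_b v / 8
     + image_prob pred_c v / 8 + image_prob pred_a v / 4"
  "word_prob S4 v = image_prob diff_a v / 3 + image_prob diff_b v / 6 + image_prob pred_c v / 6
     + image_prob diff_c v / 6 + image_prob pred_b v / 6"
  "word_prob Z v = 0"
proof (induction v)
  case (Cons x v)
  {
    case 1 show ?case using Cons.IH by (cases x) (simp_all add: image_prob_diff_Cons add_divide_distrib)
  next
    case 2 show ?case using Cons.IH by (cases x) (simp_all add: image_prob_diff_Cons add_divide_distrib)
  next
    case 3 show ?case using Cons.IH by (cases x) (simp_all add: image_prob_diff_Cons add_divide_distrib)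
  next
    case 4 show ?case using Cons.IH by (cases x) (simp_all add: image_prob_diff_Cons add_divide_distrib)
  next
    case 5 show ?case using Cons.IH by (cases x) (simp_all add: image_prob_diff_Cons add_divide_distrib)
  next
    case 6 show ?case using Cons.IH by (cases x) simp_all
  }
qed (simp_all add: image_prob_diff_Nil)

text \<open>\<open>diff_a\<close> always outputs \<open>True\<close> first, so this cylinder has
  full mass and no normalisation appears.\<close>

lemma emeasure_log_measure_True:
  "emeasure log_measure (cylinder (True # v)) = ennreal (word_prob S0 v)"
  by (simp add: emeasure_log_measure_cylinder image_prob_diff_Cons image_prob_diff_eq_word_prob
      add_divide_distrib add.commute)

lemma emeasure_log_measure_False: "emeasure log_measure (cylinder (False # v)) = 0"
  by (simp add: emeasure_log_measure_cylinder image_prob_diff_Cons)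

lemma out_prob_nonneg: "out_prob s x \<ge> 0"
  by (cases s; cases x) auto

lemma word_prob_nonneg: "word_prob s w \<ge> 0"
  by (induction w arbitrary: s) (auto simp: out_prob_nonneg)

lemma word_prob_append: "word_prob s (u @ v) = word_prob s u * word_prob (foldl next_state s u) v"
proof (induction u arbitrary: s)
  case Nil
  \<comment> \<open>At \<open>Z\<close> the factor for the empty word is 0, so
    \<open>word_prob Z v = 0\<close> is needed.\<close>
  then show ?case by (cases "s = Z") (simp_all add: image_prob_diff_eq_word_prob)
qed simp

lemma out_prob_eq_0_imp: "out_prob s x = 0 \<Longrightarrow> next_state s x = Z"
  by (cases s; cases x) auto

lemma foldl_next_state_Z [simp]: "foldl next_state Z w = Z"
proof (induction w)
  case (Cons x w)
  then show ?case by (cases x) simp_all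
qed simp

text \<open>A vanishing product has a zero factor: a transition into the absorbing state
  \<open>Z\<close>, or the final factor at \<open>Z\<close> itself. This matches the convention that
  sections at null cylinders are null.\<close>

lemma word_prob_eq_0_imp: "word_prob s w = 0 \<Longrightarrow> foldl next_state s w = Z"
  by (induction w arbitrary: s) (auto dest: out_prob_eq_0_imp split: if_splits)

lemma word_prob_singleton: "word_prob s [x] = out_prob s x"
  by (cases s; cases x) auto

definition computes :: "log_state \<Rightarrow> seq measure \<Rightarrow> bool" where
  "computes s M \<longleftrightarrow> sets M = sets seq_space \<and> (\<forall>w. emeasure M (cylinder w) = ennreal (word_prob s w))"

text \<open>Connects cylinders with the generating sets of the library's uniqueness theorem.\<close>

lemma cylinder_eq_sstart: "cylinder w = sstart UNIV w"
proof (induction w)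
  case (Cons x w)
  have "\<xi> \<in> cylinder (x # w) \<longleftrightarrow> \<xi> \<in> (##) x ` cylinder w" for \<xi>
    by (cases \<xi>) (auto simp: cylinder_def)
  then have "cylinder (x # w) = (##) x ` cylinder w"
    by blast
  with Cons show ?case by (simp only: sstart.simps)
qed (simp add: cylinder_def)

lemma cylinder_Nil [simp]: "cylinder [] = UNIV"
  by (simp add: cylinder_def)

lemma space_seq: "sets M = sets seq_space \<Longrightarrow> space M = UNIV"
  using sets_eq_imp_space_eq [of M seq_space] by (simp add: space_stream_space)

lemma computes_Z_iff: "computes Z M \<longleftrightarrow> M = null_measure seq_space"
proof
  assume *: "computes Z M"
  then have sets: "sets M = sets seq_space"
    by (simp add: computes_def)
  have "emeasure M (cylinder []) = 0"
    using * by (simp add: computes_def image_prob_diff_eq_word_prob del: cylinder_Nil)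
  then have "emeasure M (space M) = 0"
    by (simp add: space_seq [OF sets])
  then have "emeasure M E = 0" for E
    using emeasure_space [of M E] by simp
  then show "M = null_measure seq_space"
    by (intro measure_eqI) (simp_all add: sets)
qed (simp add: computes_def image_prob_diff_eq_word_prob)

lemma computes_prob_space:
  assumes "computes s M" "s \<noteq> Z"
  shows "prob_space M"
proof (rule prob_spaceI)
  have "emeasure M (cylinder []) = 1"
    using assms by (simp add: computes_def del: cylinder_Nil)
  then show "emeasure M (space M) = 1"
    using assms by (simp add: space_seq computes_def)
qed

text \<open>Cylinders determine a probability measure; the null state is treated apart, as its
  measure is not one.\<close>

lemma computes_measure_unique:
  assumes "computes s M" "computes s N"
  shows "M = N"
proof (cases "s = Z")
  case True
  with assms show ?thesis by (simp add: computes_Z_iff)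
next
  case False
  show ?thesis
    using assms False computes_prob_space
    by (intro stream_space_eq_sstart [of UNIV]) (auto simp: computes_def simp flip: cylinder_eq_sstart)
qed

text \<open>One-letter cylinders already recover the output row, and the rows differ
  pairwise.\<close>

lemma computes_state_unique:
  assumes "computes s M" "computes t M"
  shows "s = t"
proof -
  have "out_prob s x = out_prob t x" for x
  proof -
    have "ennreal (word_prob s [x]) = ennreal (word_prob t [x])"
      using assms unfolding computes_def by metis
    then show ?thesis
      by (simp only: word_prob_singleton ennreal_inj out_prob_nonneg)
  qed
  from this [of False] this [of True] show ?thesis
    by (cases s; cases t) simp_all
qed

section \<open>Sections of measures and runs of the automaton\<close>

lemma sets_section_measure: "sets (section_measure M w) = sets seq_space"
  by (simp add: section_measure_def)

text \<open>The prefix \<open>u\<close> lets this apply to \<mu> itself beyond the letter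
  \<open>True\<close>. The hypothesis at \<open>v = []\<close> makes the mass of
  \<open>cylinder u\<close> 0 or 1, so conditioning on \<open>u @ w\<close> divides by
  \<open>word_prob s w\<close> alone.\<close>

lemma computes_section:
  assumes M: "sets M = sets seq_space"
    and u: "\<And>v. emeasure M (cylinder (u @ v)) = ennreal (word_prob s v)"
  shows "computes (foldl next_state s w) (section_measure M (u @ w))"
proof (cases "word_prob s w = 0")
  case True
  then have "section_measure M (u @ w) = null_measure seq_space"
    by (simp add: section_measure_def u)
  then show ?thesis
    using word_prob_eq_0_imp [OF True] by (simp add: computes_Z_iff)
next
  case False
  then have pos: "word_prob s w > 0"
    using word_prob_nonneg [of s w] by simp
  then have "emeasure M (cylinder (u @ w)) \<noteq> 0"
    by (simp add: u)
  then have "emeasure (section_measure M (u @ w)) (cylinder v) =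
      ennreal (word_prob (foldl next_state s w) v)" for v
    using pos by (simp add: emeasure_section [OF M] u word_prob_append divide_ennreal word_prob_nonneg)
  then show ?thesis
    by (simp add: computes_def sets_section_measure)
qed

lemma computes_section_measure:
  "computes s M \<Longrightarrow> computes (foldl next_state s w) (section_measure M w)"
  using computes_section [of M "[]" s w] by (simp add: computes_def)

lemma reachable: "\<exists>w. foldl next_state S0 w = s"
proof (cases s)
  case S0 then show ?thesis by (intro exI [of _ "[]"]) simp
next
  case S1 then show ?thesis by (intro exI [of _ "[False]"]) simp
next
  case S2 then show ?thesis by (intro exI [of _ "[False, True, True]"]) simp
next
  case S3 then show ?thesis by (intro exI [of _ "[False, True]"]) simp
next
  case S4 then show ?thesis by (intro exI [of _ "[False, True, False]"]) simp
next
  case Z then show ?thesis by (intro exI [of _ "[True]"]) simp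
qed

theorem theorem8p6:
  "finite_state log_measure \<and>
   section_measure log_measure [False] = null_measure seq_space \<and>
   (\<exists>\<rho> :: log_state \<Rightarrow> seq measure.
      bij_betw \<rho> UNIV (range (section_measure (section_measure log_measure [True]))) \<and>
      \<rho> S0 = section_measure log_measure [True] \<and>
      \<rho> Z = null_measure seq_space \<and>
      (\<forall>s x. \<rho> (next_state s x) = section_measure (\<rho> s) [x] \<and>
             ennreal (out_prob s x) = emeasure (\<rho> s) (cylinder [x])))"
proof -
  let ?\<mu> = log_measure and ?\<mu>1 = "section_measure log_measure [True]"
  have sets: "sets ?\<mu> = sets seq_space"
    by (simp add: log_measure_def)
  have True_section: "computes (foldl next_state S0 w) (section_measure ?\<mu> (True # w))" for w
    using computes_section [of ?\<mu> "[True]" S0 w] sets by (simp add: emeasure_log_measure_True)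
  have False_section: "section_measure ?\<mu> (False # w) = null_measure seq_space" for w
    by (simp add: section_measure_def emeasure_log_measure_False)
  have \<mu>1: "computes S0 ?\<mu>1"
    using True_section [of "[]"] by simp
  \<comment> \<open>The word leading to \<open>s\<close> is arbitrary: all choices give the same
    measure by \<open>computes_measure_unique\<close>.\<close>
  define \<rho> where "\<rho> s = section_measure ?\<mu>1 (SOME w. foldl next_state S0 w = s)" for s
  have \<rho>: "computes s (\<rho> s)" for s
    unfolding \<rho>_def using computes_section_measure [OF \<mu>1] someI_ex [OF reachable [of s]] by metis
  have \<rho>_eqI: "computes s M \<Longrightarrow> \<rho> s = M" for s M
    using \<rho> computes_measure_unique by blast
  \<comment> \<open>Words starting with \<open>True\<close> give values of \<open>\<rho>\<close>,
    words starting with \<open>False\<close> the null measure; only the empty word remains.\<close>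
  have "range (section_measure ?\<mu>) \<subseteq> {section_measure ?\<mu> [], null_measure seq_space} \<union> \<rho> ` UNIV"
  proof (rule image_subsetI)
    fix w
    show "section_measure ?\<mu> w \<in> {section_measure ?\<mu> [], null_measure seq_space} \<union> \<rho> ` UNIV"
    proof (cases w)
      case (Cons x u)
      then show ?thesis
        using rangeI [of \<rho> "foldl next_state S0 u"] False_section [of u]
        by (cases x) (simp_all add: \<rho>_eqI [OF True_section])
    qed simp
  qed
  moreover have "finite (UNIV :: log_state set)"
  proof (rule finite_subset)
    show "UNIV \<subseteq> {S0, S1, S2, S3, S4, Z}"
      using log_state.exhaust by blast
  qed simp
  ultimately have fin: "finite_state ?\<mu>"
    unfolding finite_state_def by (meson finite.emptyI finite_Un finite_imageI finite_insert finite_subset)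
  have "inj \<rho>"
    using \<rho> computes_state_unique by (metis injI)
  moreover have "range \<rho> = range (section_measure ?\<mu>1)"
  proof (intro equalityI image_subsetI)
    show "section_measure ?\<mu>1 w \<in> range \<rho>" for w
      using \<rho>_eqI [OF computes_section_measure [OF \<mu>1, of w]] by (metis rangeI)
  qed (simp add: \<rho>_def)
  ultimately have "bij_betw \<rho> UNIV (range (section_measure ?\<mu>1))"
    by (simp add: bij_betw_def)
  moreover have "\<rho> (next_state s x) = section_measure (\<rho> s) [x]" for s x
    using computes_section_measure [OF \<rho>, of s "[x]"] by (simp add: \<rho>_eqI)
  moreover have "ennreal (out_prob s x) = emeasure (\<rho> s) (cylinder [x])" for s x
    using \<rho> [of s] by (simp only: computes_def word_prob_singleton)
  moreover have "\<rho> S0 = ?\<mu>1" "\<rho> Z = null_measure seq_space"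
    using \<mu>1 by (simp_all add: \<rho>_eqI computes_Z_iff)
  ultimately show ?thesis
    using fin False_section [of "[]"] by blast
qed

end
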